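(* For every $k\ge 1$, a matching of size $k$ has degree exactly $1$ in $\mathbf{DCM}_k$ if and only if it is an L-matching.
   Context: Let $k\ge 1$ and let $X_{2k}=\{P_1,\dots,P_{2k}\}$ be $2k$ points in convex position in the plane, labeled in clockwise cyclic order; indices are taken modulo $2k$. A matching of $X_{2k}$ means a set of $k$ pairwise non-crossing straight segments (edges) with endpoints in $X_{2k}$ covering every point exactly once; its size is $k$. Two matchings $M,M'$ of $X_{2k}$ are disjoint compatible if they have no common edge and no edge of $M$ crosses an edge of $M'$. $\mathbf{DCM}_k$ is the graph whose vertices are the matchings of $X_{2k}$, two being adjacent iff they are disjoint compatible. The rings of $X_{2k}$ ($k\ge 2$) are the two matchings consisting only of edges between consecutive points: $\{P_1P_2,P_3P_4,\dots,P_{2k-1}P_{2k}\}$ and $\{P_2P_3,P_4P_5,\dots,P_{2k}P_1\}$. A block of a matching $M$ is a pair of edges $\{P_iP_{i+3},P_{i+1}P_{i+2}\}\subseteq M$. If $K$ is a block of a matching $N$ of size $k+2$, then $N-K$ denotes the set $N\setminus K$, regarded as a matching of the remaining $2k$ points (which are in convex position) with their inherited cyclic order, i.e. as a matching of size $k$ defined up to cyclic relabeling. L-matchings are defined recursively: a matching of size $2$ or $3$ is an L-matching iff it is a ring; no matching of size $1$ is an L-matching; for $k\ge 4$, a matching $N$ of size $k$ is an L-matching iff it has a block $K$ such that $N-K$ is an L-matching. *)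

theory Defs
  imports Main
begin

text \<open>Points P_1..P_{2k} are encoded as 0..2k-1 (in cyclic order); an edge is a
2-element set of points; a matching is a set of edges.\<close>

definition crosses :: "nat set \<Rightarrow> nat set \<Rightarrow> bool" where
  "crosses e f \<longleftrightarrow> (\<exists>a b c d. e = {a, b} \<and> f = {c, d} \<and> a < b \<and>
      c \<noteq> a \<and> c \<noteq> b \<and> d \<noteq> a \<and> d \<noteq> b \<and> c \<noteq> d \<and>
      ((a < c \<and> c < b) \<noteq> (a < d \<and> d < b)))"

definition is_matching :: "nat \<Rightarrow> nat set set \<Rightarrow> bool" where
  "is_matching k M \<longleftrightarrow>
     (\<forall>e\<in>M. \<exists>a b. e = {a, b} \<and> a \<noteq> b \<and> a < 2*k \<and> b < 2*k) \<and>
     (\<forall>p<2*k. \<exists>!e. e \<in> M \<and> p \<in> e) \<and>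
     (\<forall>e\<in>M. \<forall>f\<in>M. \<not> crosses e f)"

definition disj_compat :: "nat set set \<Rightarrow> nat set set \<Rightarrow> bool" where
  "disj_compat M M' \<longleftrightarrow> M \<inter> M' = {} \<and> (\<forall>e\<in>M. \<forall>f\<in>M'. \<not> crosses e f)"

definition dcm_degree :: "nat \<Rightarrow> nat set set \<Rightarrow> nat" where
  "dcm_degree k M = card {M'. is_matching k M' \<and> disj_compat M M'}"

definition ring1 :: "nat \<Rightarrow> nat set set" where
  "ring1 k = {{2*j, 2*j+1} | j. j < k}"

definition ring2 :: "nat \<Rightarrow> nat set set" where
  "ring2 k = {{2*j+1, (2*j+2) mod (2*k)} | j. j < k}"

definition has_block_at :: "nat \<Rightarrow> nat set set \<Rightarrow> nat \<Rightarrow> bool" where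
  "has_block_at k N i \<longleftrightarrow> i < 2*k \<and>
     {i, (i+3) mod (2*k)} \<in> N \<and> {(i+1) mod (2*k), (i+2) mod (2*k)} \<in> N"

text \<open>N - K for the block at i of a matching N on n = 2k points: the remaining
points i+4, ..., i+n-1 (mod n) are relabelled 0, ..., n-5 in inherited cyclic order.\<close>
definition remove_block :: "nat \<Rightarrow> nat set set \<Rightarrow> nat \<Rightarrow> nat set set" where
  "remove_block k N i =
     (\<lambda>e. (\<lambda>x. (x + 4*k - i - 4) mod (2*k)) ` e) `
       (N - {{i, (i+3) mod (2*k)}, {(i+1) mod (2*k), (i+2) mod (2*k)}})"

inductive L_matching :: "nat \<Rightarrow> nat set set \<Rightarrow> bool" where
  ring_a: "k = 2 \<or> k = 3 \<Longrightarrow> L_matching k (ring1 k)"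
| ring_b: "k = 2 \<or> k = 3 \<Longrightarrow> L_matching k (ring2 k)"
| step: "k \<ge> 4 \<Longrightarrow> is_matching k N \<Longrightarrow> has_block_at k N i \<Longrightarrow>
          L_matching (k - 2) (remove_block k N i) \<Longrightarrow> L_matching k N"

end

theory Submission
  imports Defs
begin

text \<open>A matching cuts the disk into faces, and a compatible matching uses both end points of each edge on
the same side of that edge. At a block both edges are forced, so deleting a block does not change
the degree. Without blocks, the matching on either side of an edge that is not a side of the
polygon has a compatible matching avoiding the edge as well as one using both of its end points,
so such an edge yields two compatible matchings. The remaining block-free matchings are the rings,
which have a single compatible matching only for sizes 2 and 3.\<close>

text \<open>Filling a piece is what can fail. In a block-free matching \<open>M\<close>, an interval
  of points that no edge of \<open>M\<close> leaves has a compatible matching on all of its points,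
  unless it is a single edge \<open>{s, Suc s}\<close> of \<open>M\<close>: two points admit no
  other matching. An edge lying directly over such a lone edge forms a block with it, so blocks are
  exactly the obstruction. A long edge therefore has a fillable piece on each side, and either side
  may take up its two ends; these two choices are the two neighbours. A ring has no long edge to
  choose a side of. There the points are cut into two pieces instead, and each piece needs two ring
  edges, hence size at least 4. Pieces are intervals in the linear order of the points, whereas
  blocks and long edges are cyclic notions. Rotating the block or edge to a fixed position bridges
  the gap, and matchings on arbitrary point sets spare a relabelling of the pieces.\<close>

definition nc_matching :: "nat set \<Rightarrow> nat set set \<Rightarrow> bool" where
  "nc_matching X M \<longleftrightarrow>
     (\<forall>e\<in>M. \<exists>a b. e = {a, b} \<and> a \<noteq> b \<and> a \<in> X \<and> b \<in> X) \<and>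
     (\<forall>p\<in>X. \<exists>!e. e \<in> M \<and> p \<in> e) \<and>
     (\<forall>e\<in>M. \<forall>f\<in>M. \<not> crosses e f)"

lemma is_matching_iff: "is_matching k M \<longleftrightarrow> nc_matching {..<2*k} M"
  unfolding is_matching_def nc_matching_def by (simp add: Ball_def)

section \<open>Crossing segments\<close>

lemma crosses_obtain:
  assumes "crosses e f"
  obtains a b c d where "e = {a, b}" "f = {c, d}" "a < c" "c < b" "d < a \<or> b < d"
proof -
  obtain a b c d where e: "e = {a, b}" "f = {c, d}" and "a < b"
    "c \<noteq> a" "c \<noteq> b" "d \<noteq> a" "d \<noteq> b" "c \<noteq> d"
    "(a < c \<and> c < b) \<noteq> (a < d \<and> d < b)"
    using assms unfolding crosses_def by (elim exE conjE) (rule that; assumption)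
  then consider "a < c" "c < b" "d < a \<or> b < d" | "a < d" "d < b" "c < a \<or> b < c"
    by linarith
  then show ?thesis
    using that[of a b c d] that[of a b d c] e by cases (auto simp: insert_commute)
qed

text \<open>Neither pair is ordered, hence four cases: which end of the first segment is the left
  one, and which end of the second lies strictly between. This form suits linear arithmetic.\<close>

lemma crosses_iff:
  "crosses {a, b} {c, d} \<longleftrightarrow>
     (a < c \<and> c < b \<and> (d < a \<or> b < d)) \<or> (a < d \<and> d < b \<and> (c < a \<or> b < c)) \<or>
     (b < c \<and> c < a \<and> (d < b \<or> a < d)) \<or> (b < d \<and> d < a \<and> (c < b \<or> a < c))"
  (is "?L \<longleftrightarrow> ?R")
proof
  assume ?L
  then obtain a' b' c' d' where "{a, b} = {a', b'}" "{c, d} = {c', d'}"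
    and o: "a' < c'" "c' < b'" "d' < a' \<or> b' < d'"
    by (rule crosses_obtain)
  then have "a = a' \<and> b = b' \<or> a = b' \<and> b = a'" "c = c' \<and> d = d' \<or> c = d' \<and> d = c'"
    by (simp_all add: doubleton_eq_iff)
  then show ?R using o by (elim disjE conjE) simp_all
next
  assume R: ?R
  show ?L
  proof (cases "a < b")
    case True
    then show ?thesis using R unfolding crosses_def
      by (intro exI[of _ a] exI[of _ b] exI[of _ c] exI[of _ d]) auto
  next
    case False
    then show ?thesis using R unfolding crosses_def
      by (intro exI[of _ b] exI[of _ a] exI[of _ c] exI[of _ d]) auto
  qed
qed

lemma crosses_sym: "crosses e f \<Longrightarrow> crosses f e"
  by (erule crosses_obtain) (auto simp: crosses_iff)

text \<open>A crossing puts an end of \<open>f\<close> strictly between the ends of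
  \<open>e\<close>, hence into every interval containing \<open>e\<close>.\<close>

lemma not_crosses_outside:
  assumes "e \<subseteq> {p..<q}" "f \<inter> {p..<q} = {}"
  shows "\<not> crosses e f"
proof
  assume "crosses e f"
  then obtain a b c d where "e = {a, b}" "f = {c, d}" "a < c" "c < b" by (rule crosses_obtain)
  then show False using assms by auto
qed

lemma not_crosses_adjacent: "\<not> crosses {a, Suc a} f"
proof
  assume "crosses {a, Suc a} f"
  then obtain x y c where "{a, Suc a} = {x, y}" "x < c" "c < y" by (rule crosses_obtain)
  then show False by (auto simp: doubleton_eq_iff)
qed

lemma not_crosses_hull:
  assumes "p \<le> q" "f \<subseteq> {p..q} \<or> f \<inter> {p..q} = {}"
  shows "\<not> crosses {p, q} f"
proof
  assume "crosses {p, q} f"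
  then obtain a b c d where "{p, q} = {a, b}" "f = {c, d}" "a < c" "c < b" "d < a \<or> b < d"
    by (rule crosses_obtain)
  then show False using assms by (auto simp: doubleton_eq_iff)
qed

section \<open>Non-crossing matchings on arbitrary point sets\<close>

lemma
  assumes "nc_matching X M"
  shows nc_matching_pair: "e \<in> M \<Longrightarrow> \<exists>a b. e = {a, b} \<and> a \<noteq> b \<and> a \<in> X \<and> b \<in> X"
    and nc_matching_ex1: "p \<in> X \<Longrightarrow> \<exists>!e. e \<in> M \<and> p \<in> e"
    and nc_matching_not_crosses: "e \<in> M \<Longrightarrow> f \<in> M \<Longrightarrow> \<not> crosses e f"
  using assms by (simp_all add: nc_matching_def)

lemma nc_matching_subset: "nc_matching X M \<Longrightarrow> e \<in> M \<Longrightarrow> e \<subseteq> X"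
  by (auto dest: nc_matching_pair)

lemma nc_matching_edge_eq:
  assumes "nc_matching X M" "e \<in> M" "f \<in> M" "p \<in> e" "p \<in> f"
  shows "e = f"
proof -
  have "p \<in> X" using nc_matching_subset[OF assms(1,2)] assms(4) by auto
  from nc_matching_ex1[OF assms(1) this] show ?thesis using assms(2-5) by auto
qed

lemma nc_matching_edge:
  assumes "nc_matching X M" "e \<in> M" "p \<in> e"
  obtains r where "e = {p, r}" "p \<noteq> r" "p \<in> X" "r \<in> X"
proof -
  obtain a b where "e = {a, b}" "a \<noteq> b" "a \<in> X" "b \<in> X"
    using nc_matching_pair[OF assms(1,2)] by metis
  then show ?thesis using assms(3) that[of a] that[of b] by (auto simp: insert_commute)
qed

lemma nc_matching_partner:
  assumes "nc_matching X M" "p \<in> X"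
  obtains r where "{p, r} \<in> M" "r \<noteq> p" "r \<in> X"
proof -
  obtain e where e: "e \<in> M" "p \<in> e" using nc_matching_ex1[OF assms] by auto
  from nc_matching_edge[OF assms(1) this] obtain r where "e = {p, r}" "p \<noteq> r" "r \<in> X" .
  then show ?thesis using that[of r] e by simp
qed

lemma nc_matching_unique:
  assumes "nc_matching X M" "{p, r} \<in> M" "{p, s} \<in> M"
  shows "r = s"
proof -
  have "{p, r} = {p, s}" by (rule nc_matching_edge_eq[OF assms, of p]) simp_all
  then show ?thesis by (auto simp: doubleton_eq_iff)
qed

text \<open>An edge of \<open>B\<close> shares a point with an edge of \<open>A\<close>, which also
  lies in \<open>B\<close>; uniqueness at that point identifies the two.\<close>

lemma nc_matching_mono_eq:
  assumes "nc_matching X A" "nc_matching X B" "A \<subseteq> B"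
  shows "A = B"
proof
  show "B \<subseteq> A"
  proof
    fix e assume "e \<in> B"
    then obtain a b where e: "e = {a, b}" "a \<in> X" using nc_matching_pair[OF assms(2)] by metis
    obtain r where "{a, r} \<in> A" using nc_matching_partner[OF assms(1) e(2)] .
    then show "e \<in> A" using \<open>e \<in> B\<close> e assms nc_matching_unique[OF assms(2)] by blast
  qed
qed (fact assms(3))

lemma nc_matching_empty: "nc_matching {} {}"
  unfolding nc_matching_def by blast

lemma nc_matching_insert:
  assumes "nc_matching X M" "a \<noteq> b" "a \<notin> X" "b \<notin> X" "\<And>e. e \<in> M \<Longrightarrow> \<not> crosses {a, b} e"
  shows "nc_matching (insert a (insert b X)) (insert {a, b} M)"
proof -
  have sub: "\<And>e. e \<in> M \<Longrightarrow> e \<subseteq> X" using nc_matching_subset[OF assms(1)] .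
  have "\<not> crosses {a, b} {a, b}" by (auto simp: crosses_iff)
  moreover have "\<exists>!e. e \<in> insert {a, b} M \<and> p \<in> e" if p: "p \<in> insert a (insert b X)" for p
  proof (cases "p \<in> {a, b}")
    case True
    then have "\<forall>e\<in>M. p \<notin> e" using sub assms by blast
    then show ?thesis using True by blast
  next
    case False
    then have "p \<in> X" using p by blast
    then have "\<exists>!e. e \<in> M \<and> p \<in> e" using nc_matching_ex1[OF assms(1)] by simp
    then show ?thesis using False by blast
  qed
  moreover have "\<forall>e\<in>insert {a, b} M. \<exists>c d. e = {c, d} \<and> c \<noteq> d \<and>
      c \<in> insert a (insert b X) \<and> d \<in> insert a (insert b X)"
  proof
    fix e assume "e \<in> insert {a, b} M"
    then consider "e = {a, b}" | "e \<in> M" by blast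
    then show "\<exists>c d. e = {c, d} \<and> c \<noteq> d \<and>
      c \<in> insert a (insert b X) \<and> d \<in> insert a (insert b X)"
    proof cases
      case 1
      then show ?thesis using assms(2) by blast
    next
      case 2
      obtain c d where "e = {c, d}" "c \<noteq> d" "c \<in> X" "d \<in> X"
        using nc_matching_pair[OF assms(1) 2] by (elim exE conjE) (rule that; assumption)
      then show ?thesis by (intro exI[of _ c] exI[of _ d]) simp
    qed
  qed
  moreover have "\<not> crosses e {a, b}" if "e \<in> M" for e
    using assms(5)[OF that] crosses_sym[of e "{a, b}"] by auto
  ultimately show ?thesis
    using assms(5) nc_matching_not_crosses[OF assms(1)] unfolding nc_matching_def by simp
qed

lemma nc_matching_Un:
  assumes A: "nc_matching X A" and B: "nc_matching Y B" and d: "X \<inter> Y = {}"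
    and cr: "\<And>e f. e \<in> A \<Longrightarrow> f \<in> B \<Longrightarrow> \<not> crosses e f"
  shows "nc_matching (X \<union> Y) (A \<union> B)"
proof -
  have sub: "\<And>e. e \<in> A \<Longrightarrow> e \<subseteq> X" "\<And>e. e \<in> B \<Longrightarrow> e \<subseteq> Y"
    using nc_matching_subset A B by blast+
  have "\<exists>!e. e \<in> A \<union> B \<and> p \<in> e" if p: "p \<in> X \<union> Y" for p
  proof (cases "p \<in> X")
    case True
    then have "\<forall>e\<in>B. p \<notin> e" using sub d by blast
    moreover have "\<exists>!e. e \<in> A \<and> p \<in> e" using nc_matching_ex1[OF A True] .
    ultimately show ?thesis by blast
  next
    case False
    then have "\<forall>e\<in>A. p \<notin> e" using sub by blast
    moreover have "\<exists>!e. e \<in> B \<and> p \<in> e" using nc_matching_ex1[OF B] False p by simp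
    ultimately show ?thesis by blast
  qed
  moreover have "\<forall>e\<in>A \<union> B. \<forall>f\<in>A \<union> B. \<not> crosses e f"
    using nc_matching_not_crosses[OF A] nc_matching_not_crosses[OF B] cr crosses_sym by (metis UnE)
  moreover have "\<forall>e\<in>A \<union> B. \<exists>a b. e = {a, b} \<and> a \<noteq> b \<and> a \<in> X \<union> Y \<and> b \<in> X \<union> Y"
    using nc_matching_pair[OF A] nc_matching_pair[OF B] by (metis UnE UnI1 UnI2)
  ultimately show ?thesis unfolding nc_matching_def by simp
qed

lemma nc_matching_Diff_edge:
  assumes M: "nc_matching X M" and e: "{a, b} \<in> M"
  shows "nc_matching (X - {a, b}) (M - {{a, b}})"
proof -
  have edge: "\<exists>c d. f = {c, d} \<and> c \<noteq> d \<and> c \<in> X - {a, b} \<and> d \<in> X - {a, b}"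
    if "f \<in> M - {{a, b}}" for f
  proof -
    obtain c d where f: "f = {c, d}" "c \<noteq> d" "c \<in> X" "d \<in> X"
      using nc_matching_pair[OF M, of f] \<open>f \<in> M - {{a, b}}\<close> by auto
    have "a \<in> X" "b \<in> X" using nc_matching_subset[OF M e] by auto
    then have "a \<notin> f" "b \<notin> f"
      using nc_matching_edge_eq[OF M e, of f a] nc_matching_edge_eq[OF M e, of f b] that by auto
    then show ?thesis using f by blast
  qed
  moreover have "\<exists>!f. f \<in> M - {{a, b}} \<and> p \<in> f" if "p \<in> X - {a, b}" for p
  proof -
    have "\<exists>!f. f \<in> M \<and> p \<in> f" using that nc_matching_ex1[OF M] by simp
    then show ?thesis using that by blast
  qed
  moreover have "\<forall>e\<in>M - {{a, b}}. \<forall>f\<in>M - {{a, b}}. \<not> crosses e f"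
    using nc_matching_not_crosses[OF M] by simp
  ultimately show ?thesis unfolding nc_matching_def by simp
qed

section \<open>Neighbours of a matching\<close>

lemma disj_compat_Un:
  "disj_compat M (A \<union> B) \<longleftrightarrow> disj_compat M A \<and> disj_compat M B"
  unfolding disj_compat_def by blast

lemma disj_compat_insert:
  "disj_compat M (insert e A) \<longleftrightarrow> e \<notin> M \<and> (\<forall>f\<in>M. \<not> crosses e f) \<and> disj_compat M A"
  unfolding disj_compat_def using crosses_sym by blast

text \<open>\<open>card\<close> is 0 on infinite sets, so comparing degrees through an injection
  needs a finite target.\<close>

lemma finite_compat: "finite {M'. is_matching k M' \<and> disj_compat M M'}"
proof (rule finite_subset)
  show "{M'. is_matching k M' \<and> disj_compat M M'} \<subseteq> Pow (Pow {..<2*k})"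
    by (auto simp: is_matching_iff dest: nc_matching_subset)
qed simp

lemma degree_neq_1_if_two_neighbours:
  assumes "is_matching k A" "disj_compat M A" "is_matching k B" "disj_compat M B" "A \<noteq> B"
  shows "dcm_degree k M \<noteq> 1"
  using assms unfolding dcm_degree_def by (auto simp: card_1_singleton_iff)

subsection \<open>Rotations\<close>

definition rot :: "nat \<Rightarrow> nat \<Rightarrow> nat \<Rightarrow> nat" where
  "rot n c x = (x + c) mod n"

definition rotM :: "nat \<Rightarrow> nat \<Rightarrow> nat set set \<Rightarrow> nat set set" where
  "rotM n c M = (\<lambda>e. rot n c ` e) ` M"

lemma rot_less: "x < n \<Longrightarrow> rot n c x < n"
  unfolding rot_def by simp

text \<open>Reducing \<open>c\<close> modulo \<open>n\<close> keeps the subtraction in the inverse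
  shift \<open>n - c mod n\<close> from being truncated.\<close>

lemma rot_inverse:
  assumes "x < n"
  shows "rot n (n - c mod n) (rot n c x) = x" "rot n c (rot n (n - c mod n) x) = x"
proof -
  have n: "n > 0" "c mod n < n" using assms by auto
  have "rot n (n - c mod n) (rot n c x) = (x + (n - c mod n) + c mod n) mod n"
    "rot n c (rot n (n - c mod n) x) = (x + (n - c mod n) + c mod n) mod n"
    unfolding rot_def by (simp_all only: mod_simps) (simp add: add.assoc add.commute)
  then show "rot n (n - c mod n) (rot n c x) = x" "rot n c (rot n (n - c mod n) x) = x"
    using n assms by simp_all
qed

lemma inj_on_rot: "inj_on (rot n c) {..<n}"
  by (rule inj_on_inverseI[where g = "rot n (n - c mod n)"]) (simp add: rot_inverse)

lemma rotM_inverse: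
  assumes "\<And>e. e \<in> M \<Longrightarrow> e \<subseteq> {..<n}"
  shows "rotM n (n - c mod n) (rotM n c M) = M" "rotM n c (rotM n (n - c mod n) M) = M"
proof -
  have "rot n (n - c mod n) ` rot n c ` e = e" "rot n c ` rot n (n - c mod n) ` e = e"
    if "e \<in> M" for e
    using assms[OF that] by (force simp: image_image rot_inverse)+
  then show "rotM n (n - c mod n) (rotM n c M) = M" "rotM n c (rotM n (n - c mod n) M) = M"
    unfolding rotM_def by (auto simp: image_image)
qed

lemma crosses_rot:
  assumes "crosses e f" "e \<subseteq> {..<n}" "f \<subseteq> {..<n}"
  shows "crosses (rot n s ` e) (rot n s ` f)"
proof -
  obtain a b c d where e: "e = {a, b}" "f = {c, d}" and o: "a < c" "c < b" "d < a \<or> b < d"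
    using crosses_obtain[OF assms(1)] .
  have l: "a < n" "b < n" "c < n" "d < n" using assms e by auto
  define t where "t = s mod n"
  have t: "t < n" using l unfolding t_def by simp
  \<comment> \<open>For a shift \<open>t < n\<close> the remainder is one of two linear terms, so
    invariance of crossings under rotation becomes linear arithmetic.\<close>
  have r: "rot n s x = (if x + t < n then x + t else x + t - n)" if "x < n" for x
  proof -
    have "rot n s x = (x + t) mod n" unfolding rot_def t_def by (simp add: mod_simps)
    then show ?thesis using that t by (auto simp: mod_if)
  qed
  show ?thesis
    unfolding e image_insert image_empty crosses_iff r[OF l(1)] r[OF l(2)] r[OF l(3)] r[OF l(4)]
    using l o t by (simp split: if_split) linarith
qed

lemma crosses_rot_iff:
  assumes "e \<subseteq> {..<n}" "f \<subseteq> {..<n}"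
  shows "crosses (rot n s ` e) (rot n s ` f) \<longleftrightarrow> crosses e f"
proof
  assume c: "crosses (rot n s ` e) (rot n s ` f)"
  have inv: "rot n (n - s mod n) ` rot n s ` g = g" if "g \<subseteq> {..<n}" for g
    using that by (force simp: image_image rot_inverse)
  have "rot n s ` e \<subseteq> {..<n}" "rot n s ` f \<subseteq> {..<n}" using assms rot_less by blast+
  from crosses_rot[OF c this, of "n - s mod n"] show "crosses e f" using assms inv by simp
qed (use crosses_rot assms in blast)

lemma is_matching_rotM:
  assumes "is_matching k M"
  shows "is_matching k (rotM (2*k) c M)"
proof -
  let ?n = "2 * k" let ?d = "?n - c mod ?n"
  have M: "nc_matching {..<?n} M" using assms is_matching_iff by simp
  have sub: "e \<subseteq> {..<?n}" if "e \<in> M" for e using nc_matching_subset[OF M that] .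
  have "\<exists>!e. e \<in> rotM ?n c M \<and> p \<in> e" if p: "p < ?n" for p
  proof -
    have mem: "p \<in> rot ?n c ` e \<longleftrightarrow> rot ?n ?d p \<in> e" if "e \<in> M" for e
    proof
      assume "p \<in> rot ?n c ` e"
      then show "rot ?n ?d p \<in> e" using sub[OF that] rot_inverse(1)[of _ ?n c] by auto
    next
      assume "rot ?n ?d p \<in> e"
      then have "rot ?n c (rot ?n ?d p) \<in> rot ?n c ` e" by (rule imageI)
      then show "p \<in> rot ?n c ` e" unfolding rot_inverse(2)[OF p] .
    qed
    have "\<exists>!e. e \<in> M \<and> rot ?n ?d p \<in> e"
      using nc_matching_ex1[OF M] rot_less[OF p] by simp
    then obtain e where e: "e \<in> M" "rot ?n ?d p \<in> e"
      and u: "\<And>f. f \<in> M \<Longrightarrow> rot ?n ?d p \<in> f \<Longrightarrow> f = e" by auto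
    show ?thesis
    proof (rule ex1I[of _ "rot ?n c ` e"])
      show "rot ?n c ` e \<in> rotM ?n c M \<and> p \<in> rot ?n c ` e"
        using e mem unfolding rotM_def by simp
    next
      fix f assume "f \<in> rotM ?n c M \<and> p \<in> f"
      then obtain g where "g \<in> M" "f = rot ?n c ` g" "p \<in> rot ?n c ` g"
        unfolding rotM_def by auto
      then show "f = rot ?n c ` e" using u mem by simp
    qed
  qed
  moreover have "\<exists>a b. e = {a, b} \<and> a \<noteq> b \<and> a < ?n \<and> b < ?n" if e: "e \<in> rotM ?n c M" for e
  proof -
    obtain f where f: "f \<in> M" "e = rot ?n c ` f" using e unfolding rotM_def by auto
    then obtain a b where "e = rot ?n c ` {a, b}" "a \<noteq> b" "a < ?n" "b < ?n"
      using nc_matching_pair[OF M f(1)] by (metis lessThan_iff)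
    then show ?thesis using inj_on_rot[of ?n c] rot_less
      by (intro exI[of _ "rot ?n c a"] exI[of _ "rot ?n c b"]) (auto simp: inj_on_def)
  qed
  moreover have "\<forall>e\<in>rotM ?n c M. \<forall>f\<in>rotM ?n c M. \<not> crosses e f"
    using nc_matching_not_crosses[OF M] sub unfolding rotM_def by (simp add: crosses_rot_iff)
  ultimately show ?thesis unfolding is_matching_def by simp
qed

lemma disj_compat_rotM:
  assumes "is_matching k M" "is_matching k N" "disj_compat M N"
  shows "disj_compat (rotM (2*k) c M) (rotM (2*k) c N)"
proof -
  have sub: "e \<subseteq> {..<2*k}" if "e \<in> M \<union> N" for e
    using that assms nc_matching_subset unfolding is_matching_iff by blast
  have "rot (2*k) c ` e \<noteq> rot (2*k) c ` f" if "e \<in> M" "f \<in> N" for e f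
    using that sub assms(3) inj_on_image_eq_iff[OF inj_on_rot, of e "2*k" f c]
    unfolding disj_compat_def by blast
  then show ?thesis
    using assms(3) sub unfolding disj_compat_def rotM_def by (auto simp: crosses_rot_iff)
qed

lemma matching_rotM_inverse:
  assumes "is_matching k M"
  shows "rotM (2*k) (2*k - c mod (2*k)) (rotM (2*k) c M) = M"
  using assms by (intro rotM_inverse) (simp add: is_matching_iff nc_matching_subset)

lemma dcm_degree_rotM:
  assumes "is_matching k M"
  shows "dcm_degree k (rotM (2*k) c M) = dcm_degree k M"
proof -
  \<comment> \<open>Rotation maps neighbours injectively to neighbours, which gives one inequality;
    the inverse rotation gives the other.\<close>
  have le: "dcm_degree k A \<le> dcm_degree k (rotM (2*k) s A)" if A: "is_matching k A" for A s
    unfolding dcm_degree_def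
  proof (rule card_inj_on_le[OF _ _ finite_compat])
    show "inj_on (rotM (2*k) s) {M'. is_matching k M' \<and> disj_compat A M'}"
      by (rule inj_on_inverseI[where g = "rotM (2*k) (2*k - s mod (2*k))"])
        (simp add: matching_rotM_inverse)
  qed (use A is_matching_rotM disj_compat_rotM in auto)
  show ?thesis
    using le[OF assms, of c] le[OF is_matching_rotM[OF assms], of c "2*k - c mod (2*k)"]
    by (simp add: matching_rotM_inverse assms)
qed

lemma has_block_at_rotM:
  assumes "has_block_at k M i"
  shows "has_block_at k (rotM (2*k) c M) ((i + c) mod (2*k))"
proof -
  let ?n = "2 * k"
  have i: "i < ?n" "{i, (i+3) mod ?n} \<in> M" "{(i+1) mod ?n, (i+2) mod ?n} \<in> M"
    using assms unfolding has_block_at_def by auto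
  then have "rot ?n c ` {i, (i+3) mod ?n} \<in> rotM ?n c M"
    "rot ?n c ` {(i+1) mod ?n, (i+2) mod ?n} \<in> rotM ?n c M"
    unfolding rotM_def by blast+
  then show ?thesis using i(1) unfolding has_block_at_def rot_def
    by (simp add: mod_simps ac_simps)
qed

subsection \<open>Removing a block\<close>

text \<open>An edge of \<open>N\<close> at \<open>n + 1\<close> or \<open>n + 2\<close> cannot cross
  \<open>{n, n + 3}\<close> and cannot be \<open>{n + 1, n + 2}\<close>, so it ends at
  \<open>n\<close> or \<open>n + 3\<close>. Of the two assignments, one makes the edges
  cross.\<close>

lemma block_edges_forced:
  assumes N: "nc_matching {..<n + 4} N" and dc: "disj_compat M N"
    and M: "{n, n + 3} \<in> M" "{n + 1, n + 2} \<in> M"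
  shows "{n, n + 1} \<in> N" "{n + 2, n + 3} \<in> N"
proof -
  have cr: "\<not> crosses {n, n + 3} f" "f \<noteq> {n, n + 3}" "f \<noteq> {n + 1, n + 2}" if "f \<in> N" for f
    using dc M that unfolding disj_compat_def by blast+
  obtain r where r: "{n + 1, r} \<in> N" "r \<noteq> n + 1" "r < n + 4"
    using nc_matching_partner[OF N, of "n + 1"] by auto
  obtain s where s: "{n + 2, s} \<in> N" "s \<noteq> n + 2" "s < n + 4"
    using nc_matching_partner[OF N, of "n + 2"] by auto
  have "r = n \<or> r = n + 3" using cr[OF r(1)] r(2,3) by (auto simp: crosses_iff doubleton_eq_iff)
  moreover have "s = n \<or> s = n + 3"
    using cr[OF s(1)] s(2,3) by (auto simp: crosses_iff doubleton_eq_iff)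
  moreover have "r \<noteq> s"
    using nc_matching_unique[OF N, of r "n + 1" "n + 2"] r s by (auto simp: insert_commute)
  moreover have "\<not> crosses {n + 1, r} {n + 2, s}" using nc_matching_not_crosses[OF N r(1) s(1)] .
  ultimately have "r = n \<and> s = n + 3" by (auto simp: crosses_iff)
  then show "{n, n + 1} \<in> N" "{n + 2, n + 3} \<in> N" using r s by (simp_all add: insert_commute)
qed

text \<open>The nesting follows the insertion of \<open>{n, n + 1}\<close> and then
  \<open>{n + 2, n + 3}\<close> by \<open>nc_matching_insert\<close>.\<close>

lemma lessThan_add_4: "{..<n + 4} = insert (n + 2) (insert (n + 3) (insert n (insert (n + 1) {..<n::nat})))"
  by auto

text \<open>Applied to both pairings of the last four points that matter: the block of
  \<open>M\<close> and the two edges it forces in a neighbour.\<close>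

lemma nc_matching_Diff_two:
  assumes M: "nc_matching {..<n + 4} M" and e: "{a, b} \<in> M" "{c, d} \<in> M"
    and abcd: "{a, b} \<union> {c, d} = {n, n + 1, n + 2, n + 3}" "{a, b} \<inter> {c, d} = {}"
  shows "nc_matching {..<n} (M - {{a, b}, {c, d}})"
proof -
  have "{c, d} \<in> M - {{a, b}}" using e abcd by auto
  from nc_matching_Diff_edge[OF nc_matching_Diff_edge[OF M e(1)] this]
  have "nc_matching ({..<n + 4} - {a, b} - {c, d}) (M - {{a, b}} - {{c, d}})" .
  moreover have "{..<n + 4} - {a, b} - {c, d} = {..<n}"
  proof -
    have "{..<n + 4} - {a, b} - {c, d} = {..<n + 4} - ({a, b} \<union> {c, d})"
      by (rule set_eqI) (simp only: Diff_iff Un_iff de_Morgan_disj conj_assoc)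
    also have "\<dots> = {..<n}" unfolding abcd(1) by auto
    finally show ?thesis .
  qed
  moreover have "M - {{a, b}} - {{c, d}} = M - {{a, b}, {c, d}}" by (rule Diff_insert2[symmetric])
  ultimately show ?thesis by simp
qed

lemma dcm_degree_remove_last_block:
  assumes M: "is_matching (k + 2) M" and b: "{2*k, 2*k + 3} \<in> M" "{2*k + 1, 2*k + 2} \<in> M"
  defines "K \<equiv> {{2*k, 2*k + 3}, {2*k + 1, 2*k + 2}}"
  shows "is_matching k (M - K)" "dcm_degree (k + 2) M = dcm_degree k (M - K)"
proof -
  define n where "n = 2 * k"
  have n4: "2 * (k + 2) = n + 4" unfolding n_def by simp
  have M': "nc_matching {..<n + 4} M" using M unfolding is_matching_iff n4 .
  have b': "{n, n + 3} \<in> M" "{n + 1, n + 2} \<in> M" using b unfolding n_def .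
  have K: "K = {{n, n + 3}, {n + 1, n + 2}}" unfolding K_def n_def ..
  have MK: "nc_matching {..<n} (M - K)"
    unfolding K by (rule nc_matching_Diff_two[OF M' b']) auto
  then show "is_matching k (M - K)" unfolding is_matching_iff n_def .
  \<comment> \<open>\<open>M\<close> loses the block \<open>K\<close>, while each neighbour loses
    the forced edges \<open>?J\<close> on the same four points. Putting \<open>?J\<close> back
    inverts this.\<close>
  let ?J = "{{n, n + 1}, {n + 2, n + 3}}"
  let ?A = "{N. nc_matching {..<n + 4} N \<and> disj_compat M N}"
  let ?B = "{N. nc_matching {..<n} N \<and> disj_compat (M - K) N}"
  have "bij_betw (\<lambda>N. N - ?J) ?A ?B"
  proof (rule bij_betw_byWitness[where f' = "\<lambda>N. N \<union> ?J"])
    show "\<forall>N\<in>?A. (N - ?J) \<union> ?J = N"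
    proof
      fix N assume "N \<in> ?A"
      then have "?J \<subseteq> N" using block_edges_forced[OF _ _ b'] by simp
      then show "(N - ?J) \<union> ?J = N" by (simp only: Un_Diff_cancel2 Un_absorb2)
    qed
    show "\<forall>N\<in>?B. (N \<union> ?J) - ?J = N"
    proof
      fix N assume "N \<in> ?B"
      then have "N \<inter> ?J = {}" using nc_matching_subset[of "{..<n}" N] by auto
      then show "(N \<union> ?J) - ?J = N" by (simp only: Un_Diff Diff_cancel Un_empty_right Diff_triv)
    qed
    show "(\<lambda>N. N - ?J) ` ?A \<subseteq> ?B"
    proof safe
      fix N assume N: "nc_matching {..<n + 4} N" "disj_compat M N"
      show "nc_matching {..<n} (N - ?J)"
        using nc_matching_Diff_two[OF N(1) block_edges_forced[OF N b']] by auto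
      show "disj_compat (M - K) (N - ?J)" using N(2) unfolding disj_compat_def by blast
    qed
    show "(\<lambda>N. N \<union> ?J) ` ?B \<subseteq> ?A"
    proof safe
      fix N assume N: "nc_matching {..<n} N" "disj_compat (M - K) N"
      have N1: "nc_matching (insert n (insert (n + 1) {..<n})) (insert {n, n + 1} N)"
        using not_crosses_adjacent[of n] by (intro nc_matching_insert[OF N(1)]) auto
      have "nc_matching {..<n + 4} (insert {n + 2, n + 3} (insert {n, n + 1} N))"
        unfolding lessThan_add_4
        using not_crosses_adjacent[of "n + 2"]
        by (intro nc_matching_insert[OF N1]) (auto simp: eval_nat_numeral)
      then show "nc_matching {..<n + 4} (N \<union> ?J)" by (simp add: insert_commute)
      have "\<not> crosses e f" "e \<noteq> f" if "e \<in> K" "f \<in> N" for e f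
      proof -
        have "f \<subseteq> {..<n}" using nc_matching_subset[OF N(1) that(2)] .
        moreover have "e \<subseteq> {n..<n + 4}" "e \<noteq> {}" using that(1) unfolding K by auto
        ultimately show "\<not> crosses e f" "e \<noteq> f"
          using not_crosses_outside[of e n "n + 4" f] by fastforce+
      qed
      then have "disj_compat M N" using N(2) unfolding disj_compat_def by blast
      moreover have "{n, n + 1} \<notin> M" "{n + 2, n + 3} \<notin> M"
        using nc_matching_unique[OF M', of n "n + 1" "n + 3"] b'
          nc_matching_unique[OF M', of "n + 3" "n + 2" n] by (auto simp: insert_commute)
      ultimately show "disj_compat M (N \<union> ?J)"
        using not_crosses_adjacent[of n] not_crosses_adjacent[of "n + 2"]
        by (simp add: disj_compat_insert eval_nat_numeral)
    qed
  qed
  then show "dcm_degree (k + 2) M = dcm_degree k (M - K)"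
    unfolding dcm_degree_def is_matching_iff n4 using bij_betw_same_card n_def by auto
qed

lemma dcm_degree_remove_block:
  assumes k: "k \<ge> 2" and N: "is_matching k N" and b: "has_block_at k N i"
  shows "is_matching (k - 2) (remove_block k N i)"
    "dcm_degree k N = dcm_degree (k - 2) (remove_block k N i)"
proof -
  obtain l where l: "k = l + 2" using k le_Suc_ex by (metis add.commute)
  let ?n = "2 * k" let ?c = "4 * k - i - 4"
  let ?K = "{{i, (i+3) mod ?n}, {(i+1) mod ?n, (i+2) mod ?n}}"
  have i: "i < ?n" and KN: "?K \<subseteq> N" using b unfolding has_block_at_def by auto
  \<comment> \<open>The shift is congruent to \<open>- (i + 4)\<close> modulo \<open>?n\<close>,
    with \<open>4 * k\<close> large enough to avoid truncation; it carries the block to the last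
    four points.\<close>
  have rt: "rot ?n ?c ((i + j) mod ?n) = 2 * l + j" if "j < 4" for j
  proof -
    have "rot ?n ?c ((i + j) mod ?n) = (i + j + ?c) mod ?n" unfolding rot_def by (simp add: mod_simps)
    also have "i + j + ?c = (2 * l + j) + ?n" using i l by simp
    also have "\<dots> mod ?n = (2 * l + j) mod ?n" by (rule mod_add_self2)
    also have "\<dots> = 2 * l + j" using that l by simp
    finally show ?thesis .
  qed
  have K': "(`) (rot ?n ?c) ` ?K = {{2*l, 2*l + 3}, {2*l + 1, 2*l + 2}}"
    using rt[of 0] rt[of 1] rt[of 2] rt[of 3] i by simp
  have N': "\<And>e. e \<in> N \<Longrightarrow> e \<subseteq> {..<?n}"
    using N nc_matching_subset unfolding is_matching_iff by blast
  have inj: "inj_on ((`) (rot ?n ?c)) N"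
    using inj_on_subset[OF inj_on_image_Pow[OF inj_on_rot]] N' by (metis PowI subsetI)
  have eq: "(\<lambda>x. (x + 4*k - i - 4) mod ?n) ` e = rot ?n ?c ` e" if "e \<in> N" for e
  proof -
    have "x + 4*k - i - 4 = x + ?c" for x using i l by linarith
    then show ?thesis unfolding rot_def by simp
  qed
  have R: "remove_block k N i = rotM ?n ?c N - {{2*l, 2*l + 3}, {2*l + 1, 2*l + 2}}"
  proof -
    have "remove_block k N i = (`) (rot ?n ?c) ` (N - ?K)"
      unfolding remove_block_def by (rule image_cong[OF refl], rule eq, erule DiffD1)
    also have "\<dots> = (`) (rot ?n ?c) ` N - (`) (rot ?n ?c) ` ?K"
      by (rule inj_on_image_set_diff[OF inj]) (use KN in auto)
    finally show ?thesis unfolding K' rotM_def .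
  qed
  have "{2*l, 2*l + 3} \<in> rotM ?n ?c N" "{2*l + 1, 2*l + 2} \<in> rotM ?n ?c N"
    using image_mono[OF KN, of "(`) (rot ?n ?c)"] unfolding K' rotM_def by auto
  from dcm_degree_remove_last_block[OF _ this] is_matching_rotM[OF N] dcm_degree_rotM[OF N]
  show "is_matching (k - 2) (remove_block k N i)"
    "dcm_degree k N = dcm_degree (k - 2) (remove_block k N i)"
    unfolding R by (simp_all add: l)
qed

subsection \<open>Compatible matchings in the absence of blocks\<close>

text \<open>These are the point sets that no edge of \<open>M\<close> leaves. Such an interval is a
  row of top-level edges together with all that is nested below them.\<close>

definition saturated :: "nat set set \<Rightarrow> nat set \<Rightarrow> bool" where
  "saturated M X \<longleftrightarrow> (\<forall>e\<in>M. e \<subseteq> X \<or> e \<inter> X = {})"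

lemma saturated_Diff:
  assumes "saturated M X" "saturated M Y"
  shows "saturated M (X - Y)"
  unfolding saturated_def
proof
  fix e assume "e \<in> M"
  then have "e \<subseteq> X \<or> e \<inter> X = {}" "e \<subseteq> Y \<or> e \<inter> Y = {}" using assms unfolding saturated_def by auto
  then show "e \<subseteq> X - Y \<or> e \<inter> (X - Y) = {}" by blast
qed

text \<open>An edge meeting \<open>p\<close> or \<open>r\<close> is \<open>{p, r}\<close> itself;
  any other edge stays on one side of it because it does not cross it.\<close>

lemma saturated_edge:
  assumes M: "nc_matching X M" and e: "{p, r} \<in> M" and "p < r"
  shows "saturated M {p..r}" "saturated M {p<..<r}"
proof -
  have "f \<subseteq> {p..r} \<and> f \<inter> {p<..<r} = {} \<or> f \<subseteq> {p<..<r} \<or> f \<inter> {p..r} = {}" if f: "f \<in> M" for f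
  proof (cases "p \<in> f \<or> r \<in> f")
    case True
    then have "f = {p, r}" using nc_matching_edge_eq[OF M f e] by auto
    then show ?thesis using \<open>p < r\<close> by auto
  next
    case False
    obtain a b where ab: "f = {a, b}" using nc_matching_pair[OF M f] by auto
    then have "\<not> crosses {p, r} {a, b}" using nc_matching_not_crosses[OF M e f] by simp
    then show ?thesis using False \<open>p < r\<close> unfolding ab crosses_iff by simp linarith
  qed
  moreover have "{p<..<r} \<subseteq> {p..r}" by auto
  ultimately show "saturated M {p..r}" "saturated M {p<..<r}" unfolding saturated_def by blast+
qed

text \<open>Besides giving the first top-level edge, this replaces parity arguments: a nonempty
  saturated interval has at least two points.\<close>

lemma saturated_first_partner:
  assumes M: "nc_matching {..<n} M" and s: "saturated M {p..q}" and "p \<le> q" "q < n"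
  obtains r where "{p, r} \<in> M" "p < r" "r \<le> q"
proof -
  obtain r where r: "{p, r} \<in> M" "r \<noteq> p"
    using nc_matching_partner[OF M, of p] assms(3,4) by auto
  moreover have "{p, r} \<subseteq> {p..q}" using s r(1) \<open>p \<le> q\<close> unfolding saturated_def by auto
  ultimately show ?thesis using that[of r] by auto
qed

text \<open>If \<open>{s, t}\<close> is not in \<open>M\<close>, it can close an open filling of the
  interior. Otherwise \<open>s\<close> and \<open>t\<close> are joined to their inner neighbours,
  which exist because \<open>{s, t}\<close> is not a side, and an open filling completes the rest.
  Open fillings are assumed so that the lemma serves inside the induction for them as well as after
  it.\<close>

lemma fill_interval:
  assumes M: "nc_matching {..<n} M" and sat: "saturated M {s..t}" and "s < t" "t < n"
    and ne: "{s, t} \<in> M \<Longrightarrow> t \<noteq> Suc s"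
    and IH: "\<And>p q. saturated M {p..q} \<Longrightarrow> p < q \<Longrightarrow> s \<le> p \<Longrightarrow> q \<le> t \<Longrightarrow>
               \<exists>N. nc_matching {p<..<q} N \<and> disj_compat M N"
  shows "\<exists>N. nc_matching {s..t} N \<and> disj_compat M N \<and> ({s, t} \<notin> M \<longrightarrow> {s, t} \<in> N)"
proof (cases "{s, t} \<in> M")
  case False
  obtain N where N: "nc_matching {s<..<t} N" "disj_compat M N"
    using IH[OF sat \<open>s < t\<close>] by auto
  have "nc_matching (insert s (insert t {s<..<t})) (insert {s, t} N)"
  proof (rule nc_matching_insert[OF N(1)])
    fix e assume "e \<in> N"
    then have "e \<subseteq> {s<..<t}" by (rule nc_matching_subset[OF N(1)])
    then have "e \<subseteq> {s..t}" by auto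
    then show "\<not> crosses {s, t} e" using \<open>s < t\<close> by (intro not_crosses_hull) auto
  qed (use \<open>s < t\<close> in auto)
  moreover have "insert s (insert t {s<..<t}) = {s..t}" using \<open>s < t\<close> by auto
  moreover have "disj_compat M (insert {s, t} N)"
    unfolding disj_compat_insert
    using sat False N(2) \<open>s < t\<close> not_crosses_hull[of s t] unfolding saturated_def by simp
  ultimately show ?thesis by (intro exI[of _ "insert {s, t} N"]) simp
next
  case True
  obtain t' where t: "t = Suc t'" using \<open>s < t\<close> by (cases t) auto
  have "s < t'" using ne True \<open>s < t\<close> t by auto
  have "{s<..<t} = {Suc s..t'}" unfolding t by auto
  then have sat': "saturated M {Suc s..t'}" using saturated_edge(2)[OF M True \<open>s < t\<close>] by simp
  obtain r where "Suc s < r" "r \<le> t'"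
    using saturated_first_partner[OF M sat'] \<open>s < t'\<close> \<open>t < n\<close> t by auto
  then have st': "Suc s < t'" by simp
  obtain N where N: "nc_matching {Suc s<..<t'} N" "disj_compat M N"
    using IH[OF sat' st'] t by auto
  have N1: "nc_matching (insert s (insert (Suc s) {Suc s<..<t'})) (insert {s, Suc s} N)"
    by (rule nc_matching_insert[OF N(1)]) (auto simp: not_crosses_adjacent)
  have "nc_matching (insert t' (insert t (insert s (insert (Suc s) {Suc s<..<t'}))))
      (insert {t', t} (insert {s, Suc s} N))"
    by (rule nc_matching_insert[OF N1]) (use st' t in \<open>auto simp: not_crosses_adjacent\<close>)
  moreover have "insert t' (insert t (insert s (insert (Suc s) {Suc s<..<t'}))) = {s..t}"
    using st' t by auto
  moreover have "{s, Suc s} \<notin> M" using nc_matching_unique[OF M True, of "Suc s"] st' t by auto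
  moreover have "{t', t} \<notin> M"
    using nc_matching_unique[OF M, of t s t'] True st' t by (auto simp: insert_commute)
  ultimately show ?thesis using N(2) True
    by (intro exI[of _ "insert {t', t} (insert {s, Suc s} N)"])
      (simp add: disj_compat_insert not_crosses_adjacent t)
qed

text \<open>Each top-level edge of \<open>{p..q}\<close> is used from outside by joining its right end to the left end
of the next top-level edge; \<open>p\<close> and \<open>q\<close> are left unmatched.\<close>

lemma open_chain:
  assumes M: "nc_matching {..<n} M" and nb: "\<And>i. {i, i + 3} \<in> M \<Longrightarrow> {i + 1, i + 2} \<notin> M"
  shows "saturated M {p..q} \<Longrightarrow> p < q \<Longrightarrow> q < n \<Longrightarrow>
    \<exists>N. nc_matching {p<..<q} N \<and> disj_compat M N"
proof (induction "q - p" arbitrary: p q rule: less_induct)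
  case less
  note sat = less.prems(1) and pq = less.prems(2,3)
  obtain r where r: "{p, r} \<in> M" "p < r" "r \<le> q"
    using saturated_first_partner[OF M sat] pq by auto
  show ?case
  proof (cases "r = q")
    \<comment> \<open>A single top-level edge has no next edge to be joined to, so its interior must
      be filled completely.\<close>
    case True
    obtain q' where q: "q = Suc q'" using pq by (cases q) auto
    have eq: "{p<..<q} = {Suc p..q'}" unfolding q by auto
    show ?thesis
    proof (cases "p = q'")
      case True
      then have "{p<..<q} = {}" using q by auto
      then show ?thesis using nc_matching_empty
        by (intro exI[of _ "{}"]) (simp add: disj_compat_def)
    next
      case False
      have sat': "saturated M {Suc p..q'}"
        using saturated_edge(2)[OF M r(1,2)] \<open>r = q\<close> eq by simp
      obtain r' where "Suc p < r'" "r' \<le> q'"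
        using saturated_first_partner[OF M sat'] False pq q by auto
      then have pq': "Suc p < q'" by simp
      \<comment> \<open>Block-freeness enters here: a lone edge below \<open>{p, q}\<close> would
        form a block with it.\<close>
      have "q' \<noteq> Suc (Suc p)" if "{Suc p, q'} \<in> M"
        using that nb[of p] r(1) \<open>r = q\<close> q by (auto simp: eval_nat_numeral)
      then have "\<exists>N. nc_matching {Suc p..q'} N \<and> disj_compat M N \<and>
          ({Suc p, q'} \<notin> M \<longrightarrow> {Suc p, q'} \<in> N)"
        using pq q by (intro fill_interval[OF M sat' pq'] less.hyps) auto
      then show ?thesis unfolding eq by auto
    qed
  next
    case False
    \<comment> \<open>Cut after the first top-level edge \<open>{p, r}\<close>; the bridge
      \<open>{r, Suc r}\<close> joins the two open fillings.\<close>
    have "saturated M ({p..q} - {p..r})"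
      by (rule saturated_Diff[OF sat saturated_edge(1)[OF M r(1,2)]])
    moreover have "{p..q} - {p..r} = {Suc r..q}" using r by auto
    ultimately have sat': "saturated M {Suc r..q}" by simp
    obtain r' where "Suc r < r'" "r' \<le> q"
      using saturated_first_partner[OF M sat'] False r pq by auto
    then have rq: "Suc r < q" by simp
    have lt: "r - p < q - p" "q - Suc r < q - p" "r < n" using r rq pq by auto
    obtain A where A: "nc_matching {p<..<r} A" "disj_compat M A"
      using less.hyps[OF lt(1) saturated_edge(1)[OF M r(1,2)] r(2) lt(3)] by auto
    obtain B where B: "nc_matching {Suc r<..<q} B" "disj_compat M B"
      using less.hyps[OF lt(2) sat' rq pq(2)] by auto
    have AB: "nc_matching ({p<..<r} \<union> {Suc r<..<q}) (A \<union> B)"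
    proof (rule nc_matching_Un[OF A(1) B(1)])
      fix e f assume "e \<in> A" "f \<in> B"
      then have "e \<subseteq> {p<..<r}" "f \<subseteq> {Suc r<..<q}"
        using nc_matching_subset[OF A(1)] nc_matching_subset[OF B(1)] by auto
      then have "e \<subseteq> {p..<r}" "f \<inter> {p..<r} = {}" by fastforce+
      then show "\<not> crosses e f" by (rule not_crosses_outside)
    qed auto
    have "nc_matching (insert r (insert (Suc r) ({p<..<r} \<union> {Suc r<..<q})))
        (insert {r, Suc r} (A \<union> B))"
      by (rule nc_matching_insert[OF AB]) (auto simp: not_crosses_adjacent)
    moreover have "insert r (insert (Suc r) ({p<..<r} \<union> {Suc r<..<q})) = {p<..<q}"
      using r rq by auto
    moreover have "{r, Suc r} \<notin> M"
      using nc_matching_unique[OF M, of r p "Suc r"] r by (auto simp: insert_commute)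
    ultimately show ?thesis using A(2) B(2)
      by (intro exI[of _ "insert {r, Suc r} (A \<union> B)"])
        (simp add: disj_compat_insert disj_compat_Un not_crosses_adjacent)
  qed
qed

text \<open>\<open>open_chain\<close> discharges the assumption on open fillings in
  \<open>fill_interval\<close>.\<close>

lemma block_free_fill:
  assumes M: "nc_matching {..<n} M" and nb: "\<And>i. {i, i + 3} \<in> M \<Longrightarrow> {i + 1, i + 2} \<notin> M"
    and sat: "saturated M {s..t}" "s < t" "t < n" "{s, t} \<in> M \<Longrightarrow> t \<noteq> Suc s"
  obtains N where "nc_matching {s..t} N" "disj_compat M N" "{s, t} \<notin> M \<Longrightarrow> {s, t} \<in> N"
proof -
  have "\<exists>N. nc_matching {s..t} N \<and> disj_compat M N \<and> ({s, t} \<notin> M \<longrightarrow> {s, t} \<in> N)"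
    using sat(3) by (intro fill_interval[OF M sat] open_chain[OF M nb]) auto
  then show ?thesis using that by auto
qed

section \<open>Two neighbours from a long edge\<close>

lemma nc_matching_Un_intervals:
  assumes A: "nc_matching {a..b} A" and B: "nc_matching Y B" and d: "Y \<inter> {a..b} = {}"
  shows "nc_matching ({a..b} \<union> Y) (A \<union> B)"
proof (rule nc_matching_Un[OF A B])
  fix e f assume "e \<in> A" "f \<in> B"
  then have "e \<subseteq> {a..b}" "f \<subseteq> Y"
    using nc_matching_subset[OF A] nc_matching_subset[OF B] by auto
  then have "e \<subseteq> {a..<Suc b}" "f \<inter> {a..<Suc b} = {}" using d by fastforce+
  then show "\<not> crosses e f" by (rule not_crosses_outside)
qed (use d in auto)

lemma degree_neq_1_long_edge_0:
  assumes M: "is_matching k M" and nb: "\<And>i. \<not> has_block_at k M i"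
    and e: "{0, b} \<in> M" "1 < b" "b < 2 * k - 1"
  shows "dcm_degree k M \<noteq> 1"
proof -
  obtain l where l: "2 * k = Suc l" using e(3) by (cases "2 * k") auto
  have nc: "nc_matching {..<Suc l} M" using M unfolding is_matching_iff l .
  have bl: "b < l" using e(3) l by simp
  obtain b' where b': "b = Suc b'" using e(2) by (cases b) auto
  have nb1: "{i + 1, i + 2} \<notin> M" if "{i, i + 3} \<in> M" for i
  proof -
    have "i + 3 < Suc l" using nc_matching_subset[OF nc that] by auto
    then show ?thesis using nb[of i] that unfolding has_block_at_def l by simp
  qed
  note fill = block_free_fill[OF nc nb1]
  have "0 < b" using e by simp
  have sat0: "saturated M {0..b}" by (rule saturated_edge(1)[OF nc e(1) \<open>0 < b\<close>])
  have "{0<..<b} = {1..b'}" unfolding b' by auto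
  then have sat1: "saturated M {1..b'}" using saturated_edge(2)[OF nc e(1) \<open>0 < b\<close>] by simp
  have "saturated M {0..l}"
    unfolding saturated_def using nc_matching_subset[OF nc] by fastforce
  then have "saturated M ({0..l} - {0..b})" using sat0 by (rule saturated_Diff)
  moreover have "{0..l} - {0..b} = {Suc b..l}" by auto
  ultimately have sat2: "saturated M {Suc b..l}" by simp
  obtain r where "1 < r" "r \<le> b'"
    using saturated_first_partner[OF nc sat1] e(2) b' bl by auto
  then have b1: "1 < b'" by simp
  obtain r where "Suc b < r" "r \<le> l"
    using saturated_first_partner[OF nc sat2] bl by auto
  then have b2: "Suc b < l" by simp
  \<comment> \<open>The first neighbour is \<open>A \<union> B\<close>: the ends of
    \<open>{0, b}\<close> are used below the edge.\<close>
  obtain A where A: "nc_matching {0..b} A" "disj_compat M A"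
    using fill[OF _ sat0] e bl by auto
  \<comment> \<open>A lone edge \<open>{Suc b, l}\<close> would form with \<open>{0, b}\<close> a
    block that starts at \<open>b\<close> and wraps around to \<open>0\<close>.\<close>
  have "l \<noteq> Suc (Suc b)" if "{Suc b, l} \<in> M"
  proof
    assume l2: "l = Suc (Suc b)"
    then have k: "2 * k = b + 3" using l by simp
    have "has_block_at k M b"
      using e(1) that unfolding has_block_at_def k l2 by (simp add: insert_commute)
    then show False using nb by simp
  qed
  then obtain B where B: "nc_matching {Suc b..l} B" "disj_compat M B"
    using fill[OF _ sat2 b2] by auto
  \<comment> \<open>A lone edge \<open>{1, 2}\<close> below \<open>{0, 3}\<close> would be a block
    at \<open>0\<close>.\<close>
  have "b' \<noteq> Suc 1" if "{1, b'} \<in> M"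
    using nb1[of 0] that e b' by (auto simp: eval_nat_numeral)
  then obtain C where C: "nc_matching {1..b'} C" "disj_compat M C"
    using fill[OF _ sat1 b1] bl b' by auto
  \<comment> \<open>The second neighbour uses the ends of \<open>{0, b}\<close> outside:
    \<open>D\<close> leaves \<open>Suc b\<close> and \<open>l\<close> free, to be joined to
    \<open>b\<close> and \<open>0\<close>.\<close>
  obtain D where D: "nc_matching {Suc b<..<l} D" "disj_compat M D"
    using open_chain[OF nc nb1 sat2 b2] by auto
  have AB: "nc_matching ({0..b} \<union> {Suc b..l}) (A \<union> B)"
    by (rule nc_matching_Un_intervals[OF A(1) B(1)]) auto
  have "{0..b} \<union> {Suc b..l} = {..<2 * k}" using bl l by auto
  with AB have 1: "is_matching k (A \<union> B)" unfolding is_matching_iff by simp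
  have CD: "nc_matching ({1..b'} \<union> {Suc b<..<l}) (C \<union> D)"
    by (rule nc_matching_Un_intervals[OF C(1) D(1)]) (use b' in auto)
  have CD1: "nc_matching (insert b (insert (Suc b) ({1..b'} \<union> {Suc b<..<l})))
      (insert {b, Suc b} (C \<union> D))"
    by (rule nc_matching_insert[OF CD]) (use b' in \<open>auto simp: not_crosses_adjacent\<close>)
  have hull: "\<not> crosses {0, l} f" if "f \<subseteq> {0..l}" for f
    by (rule not_crosses_hull) (use that in auto)
  let ?E = "insert {0, l} (insert {b, Suc b} (C \<union> D))"
  have "nc_matching (insert 0 (insert l (insert b (insert (Suc b) ({1..b'} \<union> {Suc b<..<l}))))) ?E"
  proof (rule nc_matching_insert[OF CD1])
    fix f assume "f \<in> insert {b, Suc b} (C \<union> D)"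
    from nc_matching_subset[OF CD1 this]
    have "f \<subseteq> {0..l}" by (rule subset_trans) (use b2 b' in auto)
    then show "\<not> crosses {0, l} f" by (rule hull)
  qed (use b2 b' in auto)
  moreover have "insert 0 (insert l (insert b (insert (Suc b) ({1..b'} \<union> {Suc b<..<l})))) = {..<2 * k}"
    unfolding l using b' b2 by auto
  ultimately have 2: "is_matching k ?E" unfolding is_matching_iff by simp
  have "{0, l} \<notin> M" using nc_matching_unique[OF nc e(1), of l] bl by auto
  moreover have "{b, Suc b} \<notin> M"
    using nc_matching_unique[OF nc, of b 0 "Suc b"] e by (auto simp: insert_commute)
  moreover have "\<forall>f\<in>M. \<not> crosses {0, l} f"
  proof
    fix f assume "f \<in> M"
    then have "f \<subseteq> {..<Suc l}" by (rule nc_matching_subset[OF nc])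
    then show "\<not> crosses {0, l} f" by (intro hull) auto
  qed
  ultimately have 3: "disj_compat M ?E"
    using C(2) D(2) by (simp add: disj_compat_insert disj_compat_Un not_crosses_adjacent)
  \<comment> \<open>The edge \<open>{0, l}\<close> tells the neighbours apart: it is contained in
    neither \<open>{0..b}\<close> nor \<open>{Suc b..l}\<close>.\<close>
  have "{0, l} \<notin> A \<union> B"
    using nc_matching_subset[OF A(1), of "{0, l}"] nc_matching_subset[OF B(1), of "{0, l}"] bl by auto
  then have "A \<union> B \<noteq> ?E" by auto
  then show ?thesis
    using degree_neq_1_if_two_neighbours[OF 1 _ 2 3] A(2) B(2) by (simp add: disj_compat_Un)
qed

lemma degree_neq_1_long_edge:
  assumes M: "is_matching k M" and nb: "\<And>i. \<not> has_block_at k M i"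
    and e: "{a, b} \<in> M" "Suc a < b" "a \<noteq> 0 \<or> b \<noteq> 2 * k - 1"
  shows "dcm_degree k M \<noteq> 1"
proof -
  \<comment> \<open>This shift carries \<open>a\<close> to \<open>0\<close>, and hence
    \<open>{a, b}\<close> to \<open>{0, b - a}\<close>.\<close>
  let ?R = "rotM (2 * k) (2 * k - a) M"
  have nc: "nc_matching {..<2 * k} M" using M unfolding is_matching_iff .
  have ab: "a < 2 * k" "b < 2 * k" using nc_matching_subset[OF nc e(1)] by auto
  have "rot (2 * k) (2 * k - a) ` {a, b} \<in> ?R" unfolding rotM_def using e(1) by (rule imageI)
  moreover have "rot (2 * k) (2 * k - a) a = 0" unfolding rot_def using ab by simp
  moreover have "rot (2 * k) (2 * k - a) b = b - a"
  proof -
    have "b + (2 * k - a) = (b - a) + 2 * k" using ab e(2) by simp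
    then have "rot (2 * k) (2 * k - a) b = (b - a) mod (2 * k)"
      unfolding rot_def by (simp only: mod_add_self2)
    also have "\<dots> = b - a" using ab by simp
    finally show ?thesis .
  qed
  ultimately have "{0, b - a} \<in> ?R" by simp
  \<comment> \<open>A block of the rotated matching would rotate back to a block of
    \<open>M\<close>.\<close>
  moreover have "\<not> has_block_at k ?R i" for i
    using has_block_at_rotM[of k ?R i] nb matching_rotM_inverse[OF M] by metis
  moreover have "1 < b - a" "b - a < 2 * k - 1" using e ab by auto
  ultimately have "dcm_degree k ?R \<noteq> 1"
    using degree_neq_1_long_edge_0[OF is_matching_rotM[OF M]] by metis
  then show ?thesis using dcm_degree_rotM[OF M] by simp
qed

subsection \<open>Rings\<close>

lemma nc_matching_subsetI:
  assumes "nc_matching {..<n} M" "\<And>p. p < n \<Longrightarrow> \<exists>f\<in>R. f \<in> M \<and> p \<in> f"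
  shows "M \<subseteq> R"
proof
  fix e assume e: "e \<in> M"
  then obtain a b where "e = {a, b}" "a \<in> {..<n}"
    using nc_matching_pair[OF assms(1)] by metis
  then obtain f where "f \<in> R" "f \<in> M" "a \<in> f" "a \<in> e" using assms(2)[of a] by auto
  then show "e \<in> R" using nc_matching_edge_eq[OF assms(1) e, of f a] by simp
qed

text \<open>Going around the polygon, a point not matched to its predecessor is matched to its
  successor. So the side \<open>{0, 2 * k - 1}\<close> decides which ring arises.\<close>

lemma ring_if_short_edges:
  assumes M: "is_matching k M" and "k \<ge> 1"
    and short: "\<And>a b. {a, b} \<in> M \<Longrightarrow> a < b \<Longrightarrow> b = Suc a \<or> a = 0 \<and> b = 2 * k - 1"
  shows "M = ring1 k \<or> M = ring2 k"
proof -
  have nc: "nc_matching {..<2 * k} M" using M unfolding is_matching_iff .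
  have partner: "{p, Suc p} \<in> M" 
    if p: "p < 2 * k - 1" and prev: "p = 0 \<Longrightarrow> {0, 2 * k - 1} \<notin> M"
      "\<And>q. p = Suc q \<Longrightarrow> {q, p} \<notin> M" for p
  proof -
    have "p \<in> {..<2 * k}" using p by simp
    from nc_matching_partner[OF nc this] obtain r where r: "{p, r} \<in> M" "r \<noteq> p" by auto
    show ?thesis
    proof (cases "p < r")
      case True
      then show ?thesis using short[OF r(1)] r prev by auto
    next
      case False
      then show ?thesis using short[of r p] r prev p by (auto simp: insert_commute)
    qed
  qed
  show ?thesis
  proof (cases "{0, 2 * k - 1} \<in> M")
    case False
    have edges: "j < k \<Longrightarrow> {2 * j, Suc (2 * j)} \<in> M" for j
    proof (induction j)
      case 0
      then show ?case using partner[of 0] False by simp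
    next
      case (Suc j)
      have "{q, 2 * Suc j} \<notin> M" if "2 * Suc j = Suc q" for q
        using nc_matching_unique[OF nc, of q "2 * j" "2 * Suc j"] Suc that
        by (auto simp: insert_commute)
      then show ?case using partner[of "2 * Suc j"] Suc.prems by simp
    qed
    have "M \<subseteq> ring1 k"
    proof (rule nc_matching_subsetI[OF nc])
      fix p assume "p < 2 * k"
      then have "p div 2 < k" by linarith
      then have "{2 * (p div 2), Suc (2 * (p div 2))} \<in> M"
        "{2 * (p div 2), Suc (2 * (p div 2))} \<in> ring1 k"
        using edges unfolding ring1_def by auto
      moreover have "p \<in> {2 * (p div 2), Suc (2 * (p div 2))}" by (cases "even p") auto
      ultimately show "\<exists>f\<in>ring1 k. f \<in> M \<and> p \<in> f" by - (rule bexI, rule conjI, assumption+)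
    qed
    moreover have "ring1 k \<subseteq> M" using edges unfolding ring1_def by auto
    ultimately show ?thesis by simp
  next
    case True
    have edges0: "Suc j < k \<Longrightarrow> {Suc (2 * j), Suc (Suc (2 * j))} \<in> M" for j
    proof (induction j)
      case 0
      have "{0, 1} \<notin> M" using nc_matching_unique[OF nc True, of 1] 0 by auto
      then show ?case using partner[of 1] 0 by simp
    next
      case (Suc j)
      have "{q, Suc (2 * Suc j)} \<notin> M" if "Suc (2 * Suc j) = Suc q" for q
        using nc_matching_unique[OF nc, of q "Suc (2 * j)" "Suc (2 * Suc j)"] Suc that
        by (auto simp: insert_commute)
      then show ?case using partner[of "Suc (2 * Suc j)"] Suc.prems by simp
    qed
    have edges: "{2 * j + 1, (2 * j + 2) mod (2 * k)} \<in> M" if "j < k" for j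
    proof (cases "Suc j = k")
      case True
      then have "2 * j + 1 = 2 * k - 1" "2 * j + 2 = 2 * k" by auto
      then show ?thesis using \<open>{0, 2 * k - 1} \<in> M\<close> by (simp add: insert_commute)
    next
      case False
      then show ?thesis using edges0[of j] that by simp
    qed
    have "M \<subseteq> ring2 k"
    proof (rule nc_matching_subsetI[OF nc])
      fix p assume p: "p < 2 * k"
      \<comment> \<open>The index of the edge of \<open>ring2 k\<close> through \<open>p\<close>;
        point \<open>0\<close> lies on the last edge, the one that wraps around.\<close>
      define j where "j = (if p = 0 then k - 1 else (p - 1) div 2)"
      have "j < k" unfolding j_def using p by auto
      then have "{2 * j + 1, (2 * j + 2) mod (2 * k)} \<in> M"
        "{2 * j + 1, (2 * j + 2) mod (2 * k)} \<in> ring2 k"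
        using edges unfolding ring2_def by auto
      moreover have "p \<in> {2 * j + 1, (2 * j + 2) mod (2 * k)}"
      proof (cases "p = 0")
        case True
        then have "2 * j + 2 = 2 * k" unfolding j_def using \<open>k \<ge> 1\<close> by simp
        then show ?thesis using True by simp
      next
        case False
        then have "p = 2 * j + 1 \<or> p = 2 * j + 2" unfolding j_def by simp linarith
        then show ?thesis using p by auto
      qed
      ultimately show "\<exists>f\<in>ring2 k. f \<in> M \<and> p \<in> f" by - (rule bexI, rule conjI, assumption+)
    qed
    moreover have "ring2 k \<subseteq> M" using edges unfolding ring2_def by auto
    ultimately show ?thesis by simp
  qed
qed

section \<open>Degrees of the rings\<close>

lemma is_matching_ring1: "is_matching k (ring1 k)"
proof -
  have "\<exists>!e. e \<in> ring1 k \<and> p \<in> e" if p: "p < 2 * k" for p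
  proof (rule ex1I[of _ "{2 * (p div 2), 2 * (p div 2) + 1}"])
    have "p div 2 < k" using p by linarith
    moreover have "p \<in> {2 * (p div 2), 2 * (p div 2) + 1}" by (cases "even p") auto
    ultimately show "{2 * (p div 2), 2 * (p div 2) + 1} \<in> ring1 k \<and>
        p \<in> {2 * (p div 2), 2 * (p div 2) + 1}"
      unfolding ring1_def by auto
  next
    fix e assume "e \<in> ring1 k \<and> p \<in> e"
    then obtain j where j: "e = {2 * j, 2 * j + 1}" "p \<in> e" unfolding ring1_def by auto
    then have "p div 2 = j" by auto
    then show "e = {2 * (p div 2), 2 * (p div 2) + 1}" using j by simp
  qed
  moreover have "\<forall>e\<in>ring1 k. \<exists>a b. e = {a, b} \<and> a \<noteq> b \<and> a < 2*k \<and> b < 2*k"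
  proof
    fix e assume "e \<in> ring1 k"
    then obtain j where "e = {2 * j, 2 * j + 1}" "j < k" unfolding ring1_def by auto
    then show "\<exists>a b. e = {a, b} \<and> a \<noteq> b \<and> a < 2*k \<and> b < 2*k"
      by (intro exI[of _ "2 * j"] exI[of _ "2 * j + 1"]) auto
  qed
  moreover have "\<forall>e\<in>ring1 k. \<forall>f\<in>ring1 k. \<not> crosses e f"
    unfolding ring1_def using not_crosses_adjacent by auto
  ultimately show ?thesis unfolding is_matching_def by simp
qed

text \<open>Rotation invariance of the degree thus carries results on the first ring over to the
  second.\<close>

lemma ring2_eq_rotM: "ring2 k = rotM (2 * k) 1 (ring1 k)"
proof -
  have "rot (2 * k) 1 ` {2 * j, 2 * j + 1} = {2 * j + 1, (2 * j + 2) mod (2 * k)}" if "j < k" for j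
    unfolding rot_def using that by simp
  moreover have "ring1 k = (\<lambda>j. {2 * j, 2 * j + 1}) ` {..<k}" unfolding ring1_def by auto
  moreover have "ring2 k = (\<lambda>j. {2 * j + 1, (2 * j + 2) mod (2 * k)}) ` {..<k}"
    unfolding ring2_def by auto
  ultimately show ?thesis unfolding rotM_def by (simp add: image_image)
qed

lemma dcm_degree_ring2: "dcm_degree k (ring2 k) = dcm_degree k (ring1 k)"
  unfolding ring2_eq_rotM by (rule dcm_degree_rotM[OF is_matching_ring1])

lemma saturated_ring1: "saturated (ring1 k) {2 * a..2 * b + 1}"
proof -
  have "{2 * j, 2 * j + 1} \<subseteq> {2 * a..2 * b + 1} \<or> {2 * j, 2 * j + 1} \<inter> {2 * a..2 * b + 1} = {}" for j
    by (cases "a \<le> j \<and> j \<le> b") auto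
  then show ?thesis unfolding saturated_def ring1_def by auto
qed

lemma in_ring1: "{p, q} \<in> ring1 k \<Longrightarrow> p < q \<Longrightarrow> q = Suc p"
  unfolding ring1_def by (auto simp: doubleton_eq_iff)

text \<open>For \<open>a < b\<close> the piece holds at least two ring edges, so its outermost pair
  is not a ring edge and the filling uses it.\<close>

lemma ring1_fill:
  assumes "a < b" "b < k"
  obtains N where "nc_matching {2 * a..2 * b + 1} N" "disj_compat (ring1 k) N"
    "{2 * a, 2 * b + 1} \<in> N"
proof -
  have nc: "nc_matching {..<2 * k} (ring1 k)" using is_matching_ring1 is_matching_iff by simp
  have no: "{2 * a, 2 * b + 1} \<notin> ring1 k" using in_ring1[of "2 * a" "2 * b + 1"] assms by auto
  have "{i + 1, i + 2} \<notin> ring1 k" if "{i, i + 3} \<in> ring1 k" for i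
    using in_ring1[OF that] by simp
  from block_free_fill[OF nc this saturated_ring1, of a b] that no assms show ?thesis by auto
qed

text \<open>One filling of all points uses \<open>{0, 2 * k - 1}\<close>; filling the points
  \<open>0..3\<close> and the rest separately does not. The rest needs two ring edges of its own,
  whence the bound 4.\<close>

lemma dcm_degree_ring1_ge_4:
  assumes "k \<ge> 4"
  shows "dcm_degree k (ring1 k) \<noteq> 1"
proof -
  have k: "2 < k - 1" "k - 1 < k" "0 < k - 1" using assms by auto
  obtain A where A: "nc_matching {2 * 0..2 * (k - 1) + 1} A" "disj_compat (ring1 k) A"
      "{2 * 0, 2 * (k - 1) + 1} \<in> A"
    using ring1_fill[OF k(3,2)] by auto
  obtain B where B: "nc_matching {2 * 0..2 * 1 + 1} B" "disj_compat (ring1 k) B"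
    using ring1_fill[of 0 1 k] assms by auto
  obtain C where C: "nc_matching {2 * 2..2 * (k - 1) + 1} C" "disj_compat (ring1 k) C"
    using ring1_fill[OF k(1,2)] by auto
  have "nc_matching ({2 * 0..2 * 1 + 1} \<union> {2 * 2..2 * (k - 1) + 1}) (B \<union> C)"
    by (rule nc_matching_Un_intervals[OF B(1) C(1)]) auto
  moreover have "{2 * 0..2 * 1 + 1} \<union> {2 * 2..2 * (k - 1) + 1} = {..<2 * k}" using assms by auto
  ultimately have 1: "is_matching k (B \<union> C)" unfolding is_matching_iff by simp
  have "{2 * 0..2 * (k - 1) + 1} = {..<2 * k}" using assms by auto
  then have 2: "is_matching k A" using A unfolding is_matching_iff by simp
  have "{2 * 0, 2 * (k - 1) + 1} \<notin> B \<union> C"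
    using nc_matching_subset[OF B(1), of "{2 * 0, 2 * (k - 1) + 1}"]
      nc_matching_subset[OF C(1), of "{2 * 0, 2 * (k - 1) + 1}"] assms by auto
  then have "A \<noteq> B \<union> C" using A(3) by auto
  then show ?thesis
    using degree_neq_1_if_two_neighbours[OF 2 A(2) 1] B(2) C(2) by (simp add: disj_compat_Un)
qed

text \<open>The empty matching is vacuously compatible with everything, itself included. This is
  what deleting the block of a ring of size 2 leads to.\<close>

lemma dcm_degree_0: "dcm_degree 0 M = 1"
proof -
  have "is_matching 0 N \<longleftrightarrow> N = {}" for N unfolding is_matching_def by auto
  then have "{N. is_matching 0 N \<and> disj_compat M N} = {{}}" by (auto simp: disj_compat_def)
  then show ?thesis unfolding dcm_degree_def by simp
qed

lemma dcm_degree_1: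
  assumes "is_matching 1 M"
  shows "dcm_degree 1 M = 0"
proof -
  have "{0, 1} \<in> N" if "is_matching 1 N" for N
  proof -
    have N: "nc_matching {..<2} N" using that unfolding is_matching_iff by simp
    obtain r where "{0, r} \<in> N" "r \<noteq> 0" "r < 2" using nc_matching_partner[OF N, of 0] by auto
    moreover from this have "r = 1" by simp
    ultimately show ?thesis by simp
  qed
  then have "{N. is_matching 1 N \<and> disj_compat M N} = {}"
    using assms unfolding disj_compat_def by blast
  then show ?thesis unfolding dcm_degree_def by (simp only: card.empty)
qed

lemma dcm_degree_ring1_2: "dcm_degree 2 (ring1 2) = 1"
proof -
  have "{0, 1} \<in> ring1 2" "{2, 3} \<in> ring1 2" unfolding ring1_def by force+
  \<comment> \<open>On four points a ring is itself a block: modulo 4 the edge \<open>{1, 0}\<close>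
    lies over \<open>{2, 3}\<close>.\<close>
  then have "has_block_at 2 (ring1 2) 1" unfolding has_block_at_def
    by (simp add: insert_commute flip: numeral_2_eq_2)
  from dcm_degree_remove_block(2)[OF _ is_matching_ring1 this] show ?thesis
    by (simp add: dcm_degree_0)
qed

text \<open>A ring of size 3 has no block to delete, so its neighbour is found by following the
  possible partners of each point.\<close>

lemma dcm_degree_ring1_3: "dcm_degree 3 (ring1 3) = 1"
proof -
  have R: "{0, 1} \<in> ring1 3" "{2, 3} \<in> ring1 3" "{4, 5} \<in> ring1 3" unfolding ring1_def by force+
  have forced: "{0, 5} \<in> N \<and> {1, 2} \<in> N \<and> {3, 4} \<in> N"
    if "is_matching 3 N" and dc: "disj_compat (ring1 3) N" for N
  proof -
    have N: "nc_matching {..<6} N" using that unfolding is_matching_iff by simp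
    have out: "{0, 1} \<notin> N" "{2, 3} \<notin> N" "{4, 5} \<notin> N"
      using dc R unfolding disj_compat_def by auto
    have ex: "\<exists>r. {p, r} \<in> N \<and> r \<noteq> p \<and> r < 6" if "p < 6" for p
      using nc_matching_partner[OF N, of p] that by auto
    obtain a b c d e f where
      P: "{0, a} \<in> N" "{1, b} \<in> N" "{2, c} \<in> N" "{3, d} \<in> N" "{4, e} \<in> N" "{5, f} \<in> N" and
      Q: "a \<noteq> 0" "a < 6" "b \<noteq> 1" "b < 6" "c \<noteq> 2" "c < 6" "d \<noteq> 3" "d < 6" "e \<noteq> 4" "e < 6"
        "f \<noteq> 5" "f < 6"
      using ex[of 0] ex[of 1] ex[of 2] ex[of 3] ex[of 4] ex[of 5] by auto
    have inv: "{q, s} \<in> N \<Longrightarrow> r = q \<Longrightarrow> {p, r} \<in> N \<Longrightarrow> s = p" for p q r s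
      using nc_matching_unique[OF N, of q s p] by (simp add: insert_commute)
    have O: "a \<noteq> 1" "b \<noteq> 0" "c \<noteq> 3" "d \<noteq> 2" "e \<noteq> 5" "f \<noteq> 4"
      using out P insert_commute[of 1 0 "{}"] insert_commute[of 3 2 "{}"] insert_commute[of 5 4 "{}"]
      by metis+
    note X = nc_matching_not_crosses[OF N P(1) P(2), unfolded crosses_iff]
      nc_matching_not_crosses[OF N P(1) P(6), unfolded crosses_iff]
      nc_matching_not_crosses[OF N P(2) P(3), unfolded crosses_iff]
    have lt6: "x = 0 \<or> x = 1 \<or> x = 2 \<or> x = 3 \<or> x = 4 \<or> x = 5" if "x < 6" for x :: nat
      using that by linarith
    \<comment> \<open>Partner \<open>2\<close> of \<open>0\<close> isolates \<open>1\<close>,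
      partner \<open>4\<close> isolates \<open>5\<close>, and partner \<open>3\<close> leaves only
      the ring edge \<open>{4, 5}\<close> for \<open>4\<close>.\<close>
    have "a = 2 \<or> a = 3 \<or> a = 4 \<or> a = 5" using lt6[OF Q(2)] Q(1) O(1) by simp
    then have a: "a = 5"
    proof (elim disjE)
      assume a: "a = 2"
      then have "b = 2" using X(1) lt6[OF Q(4)] Q(3) O(2) by (elim disjE) simp_all
      then show ?thesis using a inv[OF P(3) _ P(1)] inv[OF P(3) _ P(2)] by simp
    next
      assume a: "a = 3"
      have "b \<noteq> 3" using a inv[OF P(4) _ P(1)] inv[OF P(4) _ P(2)] by auto
      then have b: "b = 2" using a X(1) lt6[OF Q(4)] Q(3) O(2) by (elim disjE) simp_all
      have "e \<noteq> 0" using a inv[OF P(1) _ P(5)] by auto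
      moreover have "e \<noteq> 1" using b inv[OF P(2) _ P(5)] by auto
      moreover have "e \<noteq> 2" using b inv[OF P(3) _ P(5)] inv[OF P(3) _ P(2)] by auto
      moreover have "e \<noteq> 3" using a inv[OF P(4) _ P(5)] inv[OF P(4) _ P(1)] by auto
      ultimately show ?thesis using lt6[OF Q(10)] Q(9) O(5) by simp
    next
      assume a: "a = 4"
      have "f \<noteq> 0" using a inv[OF P(1) _ P(6)] by auto
      then show ?thesis using a X(2) lt6[OF Q(12)] Q(11) O(6) by (elim disjE) simp_all
    qed
    have f: "f = 0" using a inv[OF P(6) _ P(1)] by simp
    then have "b \<noteq> 5" using inv[OF P(6) _ P(2)] by auto
    \<comment> \<open>Partner \<open>3\<close> of \<open>1\<close> isolates \<open>2\<close>, and
      partner \<open>4\<close> leaves only the ring edge \<open>{2, 3}\<close> for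
      \<open>2\<close>.\<close>
    then have "b = 2 \<or> b = 3 \<or> b = 4" using lt6[OF Q(4)] Q(3) O(2) by simp
    then have b: "b = 2"
    proof (elim disjE)
      assume b: "b = 3"
      have "c \<noteq> 1" using b inv[OF P(2) _ P(3)] by auto
      then show ?thesis using b X(3) lt6[OF Q(6)] Q(5) O(3) by (elim disjE) simp_all
    next
      assume b: "b = 4"
      have "c \<noteq> 0" using a inv[OF P(1) _ P(3)] by auto
      moreover have "c \<noteq> 1" using b inv[OF P(2) _ P(3)] by auto
      moreover have "c \<noteq> 4" using b inv[OF P(5) _ P(3)] inv[OF P(5) _ P(2)] by auto
      moreover have "c \<noteq> 5" using f inv[OF P(6) _ P(3)] by auto
      ultimately show ?thesis using lt6[OF Q(6)] Q(5) O(3) by simp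
    qed
    have "d \<noteq> 0" using a inv[OF P(1) _ P(4)] by auto
    moreover have "d \<noteq> 1" using b inv[OF P(2) _ P(4)] by auto
    moreover have "d \<noteq> 5" using f inv[OF P(6) _ P(4)] by auto
    ultimately have "d = 4" using lt6[OF Q(8)] Q(7) O(4) by simp
    then show ?thesis using P a b by simp
  qed
  \<comment> \<open>Existence comes from the general filling; the forced edges cover all points and
    give uniqueness.\<close>
  obtain A where "nc_matching {2 * 0..2 * 2 + 1} A" and A: "disj_compat (ring1 3) A"
    using ring1_fill[of 0 2 3] by auto
  moreover have "{2 * 0..2 * 2 + 1} = {..<2 * (3::nat)}" by auto
  ultimately have mA: "is_matching 3 A" unfolding is_matching_iff by simp
  have "B = A" if B: "is_matching 3 B" "disj_compat (ring1 3) B" for B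
  proof -
    have "B \<subseteq> A"
    proof (rule nc_matching_subsetI)
      show "nc_matching {..<2 * 3} B" using B(1) unfolding is_matching_iff .
      fix p :: nat assume "p < 2 * 3"
      then have "p \<in> {0, 5} \<or> p \<in> {1, 2} \<or> p \<in> {3, 4}" by auto
      then show "\<exists>f\<in>A. f \<in> B \<and> p \<in> f" using forced[OF B] forced[OF mA A] by blast
    qed
    then show ?thesis
      using nc_matching_mono_eq B(1) mA unfolding is_matching_iff by blast
  qed
  then have "is_matching 3 N \<and> disj_compat (ring1 3) N \<longleftrightarrow> N = A" for N
    using mA A by metis
  then show ?thesis unfolding dcm_degree_def by simp
qed

subsection \<open>The characterisation\<close>

lemma not_L_matching_1: "\<not> L_matching 1 M"
  by (subst L_matching.simps) auto

lemma L_matching_small: "k = 2 \<or> k = 3 \<Longrightarrow> L_matching k M \<longleftrightarrow> M = ring1 k \<or> M = ring2 k"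
  by (subst L_matching.simps) auto

lemma L_matching_large:
  "k \<ge> 4 \<Longrightarrow> L_matching k M \<longleftrightarrow>
     is_matching k M \<and> (\<exists>i. has_block_at k M i \<and> L_matching (k - 2) (remove_block k M i))"
  by (subst L_matching.simps) auto

text \<open>A single point strictly between \<open>a\<close> and \<open>b\<close> would have no
  partner.\<close>

lemma edge_length_ge_3:
  assumes M: "is_matching k M" and e: "{a, b} \<in> M" "Suc a < b"
  shows "b \<ge> a + 3"
proof -
  have nc: "nc_matching {..<2 * k} M" using M unfolding is_matching_iff .
  have "b < 2 * k" using nc_matching_subset[OF nc e(1)] by auto
  have "saturated M {a<..<b}" using saturated_edge(2)[OF nc e(1)] e(2) by simp
  moreover have "{a<..<b} = {Suc a..b - 1}" using e(2) by auto
  ultimately have "saturated M {Suc a..b - 1}" by simp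
  moreover have "Suc a \<le> b - 1" "b - 1 < 2 * k" using e(2) \<open>b < 2 * k\<close> by auto
  ultimately obtain r where "Suc a < r" "r \<le> b - 1" using saturated_first_partner[OF nc] by metis
  then show ?thesis by simp
qed

lemma ring_degree_eq_1:
  assumes "k = 2 \<or> k = 3" "M = ring1 k \<or> M = ring2 k"
  shows "dcm_degree k M = 1"
  using assms dcm_degree_ring1_2 dcm_degree_ring1_3 dcm_degree_ring2 by auto

lemma block_or_ring_if_degree_1:
  assumes M: "is_matching k M" and "k \<ge> 1" and d: "dcm_degree k M = 1"
    and nb: "\<And>i. \<not> has_block_at k M i"
  shows "M = ring1 k \<or> M = ring2 k"
proof (rule ring_if_short_edges[OF M \<open>k \<ge> 1\<close>])
  fix a b assume "{a, b} \<in> M" "a < b"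
  then show "b = Suc a \<or> a = 0 \<and> b = 2 * k - 1"
    using degree_neq_1_long_edge[OF M nb, of a b] d by fastforce
qed

theorem mainTheorem13:
  fixes k :: nat and M :: "nat set set"
  assumes "k \<ge> 1" and "is_matching k M"
  shows "dcm_degree k M = 1 \<longleftrightarrow> L_matching k M"
  using assms
proof (induction k arbitrary: M rule: less_induct)
  case (less k)
  note M = less.prems(2)
  consider "k = 1" | "k = 2" | "k = 3" | "k \<ge> 4" using less.prems(1) by linarith
  then show ?case
  proof cases
    case 1
    then show ?thesis using dcm_degree_1 M not_L_matching_1 by simp
  next
    case 2
    \<comment> \<open>On four points, length at least 3 leaves only \<open>{0, 3}\<close>, which is
      again a side.\<close>
    have "b = Suc a \<or> a = 0 \<and> b = 2 * k - 1" if e: "{a, b} \<in> M" "a < b" for a b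
    proof -
      have "b < 2 * k" using nc_matching_subset[OF _ e(1)] M unfolding is_matching_iff by fastforce
      then show ?thesis using edge_length_ge_3[OF M e(1)] e(2) 2 by fastforce
    qed
    then have "M = ring1 k \<or> M = ring2 k" using ring_if_short_edges[OF M less.prems(1)] by simp
    then show ?thesis using ring_degree_eq_1[of k M] L_matching_small[of k M] 2 by metis
  next
    case 3
    \<comment> \<open>Deleting a block leaves size 1, where the degree is 0.\<close>
    have "dcm_degree k M \<noteq> 1" if "has_block_at k M i" for i
      using dcm_degree_remove_block[OF _ M that] dcm_degree_1[of "remove_block k M i"] 3 by simp
    then have "dcm_degree k M = 1 \<Longrightarrow> M = ring1 k \<or> M = ring2 k"
      using block_or_ring_if_degree_1[OF M less.prems(1)] by blast
    then show ?thesis using ring_degree_eq_1[of k M] L_matching_small[of k M] 3 by metis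
  next
    case 4
    \<comment> \<open>This holds for every block, so any one block settles both directions.\<close>
    have IH: "dcm_degree k M = 1 \<longleftrightarrow> L_matching (k - 2) (remove_block k M i)"
      if "has_block_at k M i" for i
      using dcm_degree_remove_block[OF _ M that] less.IH[of "k - 2" "remove_block k M i"] 4 by simp
    have "M \<noteq> ring1 k" "M \<noteq> ring2 k" if "dcm_degree k M = 1"
      using that dcm_degree_ring1_ge_4[OF 4] dcm_degree_ring2[of k] by auto
    \<comment> \<open>Without a block, degree 1 would make \<open>M\<close> a ring, and rings of
      this size have another degree.\<close>
    then have "\<exists>i. has_block_at k M i" if "dcm_degree k M = 1"
      using block_or_ring_if_degree_1[OF M less.prems(1)] that by blast
    then show ?thesis using IH L_matching_large[OF 4] M by blast
  qed
qed

end
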